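(* There is a function $F(d)$ such that the following holds. Let $C\subset\mathbb{R}^d$ be a convex body and $\mu$ a non-$C$-degenerate measure on $\mathbb{R}^d$ such that $\mu(C)>0$ and $\mu(\mathbb{R}^d)=\infty$. Then $\Theta_H(\mu,C)\le F(d)$.
   Context: A convex body is a convex compact set with nonempty interior; a homothet of $C$ is $\lambda C+x$ with $\lambda>0$, $x\in\mathbb{R}^d$. Measures are Borel measures on $\mathbb{R}^d$ finite on compact sets; $\mu$ is non-$C$-degenerate if it vanishes on the boundary of every homothet of $C$. Let $B^d$ be the open unit Euclidean ball centered at the origin. For a family $\mathcal{A}$ of sets of finite measure and a set $D$ of finite positive measure, $d_{\mathrm{inn}}(\mu,\mathcal{A}|D)=\frac{1}{\mu(D)}\sum_{A\in\mathcal{A},A\subset D}\mu(A)$, and $d_{\mathrm{low}}(\mu,\mathcal{A})=\liminf_{r\to\infty}d_{\mathrm{inn}}(\mu,\mathcal{A}|rB^d)$. The homothety covering density with respect to $\mu$ is $\Theta_H(\mu,C)=\inf\{d_{\mathrm{low}}(\mu,\mathcal{C})\}$, where the infimum is over all coverings $\mathcal{C}$ of $\mathbb{R}^d$ (families whose union is $\mathbb{R}^d$) by homothets of $C$ each of $\mu$-measure exactly $\mu(C)$. *)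

theory Defs
  imports "HOL-Analysis.Analysis"
begin

definition convex_body :: "'a::euclidean_space set \<Rightarrow> bool" where
  "convex_body C \<longleftrightarrow> convex C \<and> compact C \<and> interior C \<noteq> {}"

definition homothet :: "real \<Rightarrow> 'a::euclidean_space \<Rightarrow> 'a set \<Rightarrow> 'a set" where
  "homothet l x C = (\<lambda>y. l *\<^sub>R y + x) ` C"

definition is_homothet_of :: "'a::euclidean_space set \<Rightarrow> 'a set \<Rightarrow> bool" where
  "is_homothet_of A C \<longleftrightarrow> (\<exists>l x. l > 0 \<and> A = homothet l x C)"

definition locally_finite_borel :: "'a::euclidean_space measure \<Rightarrow> bool" where
  "locally_finite_borel \<mu> \<longleftrightarrow> sets \<mu> = sets borel \<and>
     (\<forall>K. compact K \<longrightarrow> emeasure \<mu> K < \<infinity>)"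

definition non_degenerate :: "'a::euclidean_space measure \<Rightarrow> 'a set \<Rightarrow> bool" where
  "non_degenerate \<mu> C \<longleftrightarrow>
     (\<forall>l x. l > 0 \<longrightarrow> emeasure \<mu> (frontier (homothet l x C)) = 0)"

text \<open>Sum of the measures of the members of a family contained in D
  (sum of nonnegative terms = supremum of finite partial sums), divided by mu(D).\<close>
definition d_inn :: "'a::euclidean_space measure \<Rightarrow> 'a set set \<Rightarrow> 'a set \<Rightarrow> ennreal" where
  "d_inn \<mu> \<A> D =
     (SUP F \<in> {F. finite F \<and> F \<subseteq> {A \<in> \<A>. A \<subseteq> D}}. \<Sum>A\<in>F. emeasure \<mu> A) / emeasure \<mu> D"

definition d_low :: "'a::euclidean_space measure \<Rightarrow> 'a set set \<Rightarrow> ennreal" where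
  "d_low \<mu> \<A> = Liminf at_top (\<lambda>r::real. d_inn \<mu> \<A> (ball 0 r))"

definition homothety_covering_density :: "'a::euclidean_space measure \<Rightarrow> 'a set \<Rightarrow> ennreal" where
  "homothety_covering_density \<mu> C =
     (INF \<C> \<in> {\<C>. \<Union>\<C> = UNIV \<and>
                 (\<forall>A\<in>\<C>. is_homothet_of A C \<and> emeasure \<mu> A = emeasure \<mu> C)}. d_low \<mu> \<C>)"

end

theory Submission
  imports Defs
begin

text \<open>By Helly's theorem, \<open>C\<close> may be translated so that \<open>- C \<subseteq> d C\<close>. Non-degeneracy makes
  \<open>\<mu> (x + r C)\<close> continuous in \<open>r\<close>, so every point \<open>x\<close> is the centre of a homothet of measure
  \<open>\<mu> C\<close>. Choosing centres in a bounded set greedily by almost decreasing size, as in Besicovitch's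
  covering theorem, gives a finite covering of that set. If a point \<open>p\<close> lies in the chosen
  homothets \<open>x\<^sub>i + r\<^sub>i C\<close>, write \<open>p = x\<^sub>i + r\<^sub>i v\<^sub>i\<close>: the points \<open>v\<^sub>i \<in> C\<close> carry disjoint copies
  of a fixed multiple of \<open>C\<close>, whence comparing volumes bounds the multiplicity in terms of \<open>d\<close>.

  The space is then covered shell by shell. Homothets from the shells outside a ball are not
  contained in it, and because \<open>\<mu>\<close> has infinite mass the radii can grow so fast that the finitely
  many homothets of all earlier shells are negligible, which suffices for a lower density.\<close>

section \<open>Homothets\<close>

lemma mem_homothet: "p \<in> homothet r x C \<longleftrightarrow> (\<exists>v\<in>C. p = r *\<^sub>R v + x)"
  by (auto simp: homothet_def)

lemma homothet_homothet:
  "homothet r x (homothet s y C) = homothet (r * s) (r *\<^sub>R y + x) C"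
  by (auto simp: homothet_def image_image algebra_simps)

lemma compact_homothet: "compact C \<Longrightarrow> compact (homothet r x C)"
  unfolding homothet_def by (intro compact_continuous_image continuous_intros)

lemma convex_homothet: "convex C \<Longrightarrow> convex (homothet r x C)"
  unfolding homothet_def
  using convex_translation[OF convex_scaling[of C r], of x]
  by (simp add: image_image add.commute)

lemma measure_lebesgue_homothet:
  fixes C :: "'a::euclidean_space set"
  assumes "r \<ge> 0"
  shows "measure lebesgue (homothet r x C) = r ^ DIM('a) * measure lebesgue C"
  using assms unfolding homothet_def measure_lebesgue_affine by simp

lemma mem_homothet_iff:
  assumes "r \<noteq> 0"
  shows "p \<in> homothet r x C \<longleftrightarrow> (p - x) /\<^sub>R r \<in> C"
proof -
  have "p = r *\<^sub>R v + x \<longleftrightarrow> v = (p - x) /\<^sub>R r" for v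
    using assms by auto
  then show ?thesis
    by (simp add: mem_homothet)
qed

lemma homothet_subset_cball:
  assumes "C \<subseteq> cball 0 b" "r \<ge> 0"
  shows "homothet r x C \<subseteq> cball x (r * b)"
proof
  fix p assume "p \<in> homothet r x C"
  then obtain v where "v \<in> C" "p = r *\<^sub>R v + x"
    by (auto simp: mem_homothet)
  then show "p \<in> cball x (r * b)"
    using assms by (auto simp: dist_norm subset_iff intro!: mult_left_mono)
qed

lemma cball_subset_homothet:
  assumes "cball 0 b \<subseteq> C" "r > 0"
  shows "cball x (r * b) \<subseteq> homothet r x C"
proof
  fix p assume "p \<in> cball x (r * b)"
  then have "norm (p - x) / r \<le> b"
    using assms by (simp add: dist_norm norm_minus_commute pos_divide_le_eq mult.commute)
  then have "(p - x) /\<^sub>R r \<in> cball 0 b"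
    using assms by (simp add: divide_inverse_commute)
  then show "p \<in> homothet r x C"
    using assms by (auto simp: mem_homothet_iff)
qed

lemma homothet_add_mem:
  assumes "convex C" "0 \<le> s" "0 \<le> t" and "p \<in> homothet s x C" "q \<in> homothet t y C"
  shows "p + q \<in> homothet (s + t) (x + y) C"
proof -
  obtain u v where uv: "u \<in> C" "p = s *\<^sub>R u + x" "v \<in> C" "q = t *\<^sub>R v + y"
    using assms by (auto simp: mem_homothet)
  show ?thesis
  proof (cases "s + t = 0")
    case True
    then have "s = 0" "t = 0"
      using assms by auto
    then show ?thesis
      using uv by (auto simp: mem_homothet)
  next
    case False
    then have "s / (s + t) + t / (s + t) = 1"
      by (simp add: add_divide_distrib[symmetric])
    then have "(s / (s + t)) *\<^sub>R u + (t / (s + t)) *\<^sub>R v \<in> C"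
      using assms uv by (intro convexD) auto
    moreover have "p + q = (s + t) *\<^sub>R ((s / (s + t)) *\<^sub>R u + (t / (s + t)) *\<^sub>R v) + (x + y)"
      using False uv by (simp add: scaleR_add_right)
    ultimately show ?thesis
      unfolding mem_homothet by blast
  qed
qed

lemma homothet_mono:
  assumes "convex C" "c \<in> C" "0 \<le> s" "s \<le> t"
  shows "homothet s (x - s *\<^sub>R c) C \<subseteq> homothet t (x - t *\<^sub>R c) C"
proof
  fix p assume p: "p \<in> homothet s (x - s *\<^sub>R c) C"
  have "0 \<in> homothet (t - s) (- ((t - s) *\<^sub>R c)) C"
    using assms by (auto simp: mem_homothet)
  then have "p + 0 \<in> homothet (s + (t - s)) (x - s *\<^sub>R c + - ((t - s) *\<^sub>R c)) C"
    using assms p by (intro homothet_add_mem) auto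
  then show "p \<in> homothet t (x - t *\<^sub>R c) C"
    by (simp add: algebra_simps)
qed

lemma homothet_subset_of_mem:
  assumes "convex C" "u \<in> C" "0 \<le> s"
  shows "homothet s u C \<subseteq> homothet (1 + s) 0 C"
proof
  fix p assume "p \<in> homothet s u C"
  then obtain w where w: "w \<in> C" "p = s *\<^sub>R w + u"
    by (auto simp: mem_homothet)
  have "u \<in> homothet 1 0 C" "s *\<^sub>R w \<in> homothet s 0 C"
    using assms w(1) by (auto simp: mem_homothet)
  then have "u + s *\<^sub>R w \<in> homothet (1 + s) (0 + 0) C"
    using assms by (intro homothet_add_mem) auto
  then show "p \<in> homothet (1 + s) 0 C"
    by (simp add: w(2) add.commute)
qed

lemma sum_mem_homothet:
  assumes "convex C" "C \<noteq> {}" "finite Y" "Y \<subseteq> C"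
  shows "\<Sum>Y \<in> homothet (real (card Y)) 0 C"
  using assms(3,4)
proof (induction Y)
  case empty
  then show ?case
    using assms by (auto simp: mem_homothet)
next
  case (insert y Y)
  have "y \<in> homothet 1 0 C"
    using insert by (simp add: homothet_def)
  then have "y + \<Sum>Y \<in> homothet (1 + real (card Y)) (0 + 0) C"
    using insert assms by (intro homothet_add_mem) auto
  then show ?case
    using insert by simp
qed

lemma is_homothet_of_homothet:
  assumes "s > 0"
  shows "is_homothet_of A (homothet s y C) \<longleftrightarrow> is_homothet_of A C"
proof
  assume "is_homothet_of A (homothet s y C)"
  then show "is_homothet_of A C"
    using assms unfolding is_homothet_of_def homothet_homothet by (metis mult_pos_pos)
next
  assume "is_homothet_of A C"
  then obtain r x where A: "r > 0" "A = homothet r x C"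
    by (auto simp: is_homothet_of_def)
  then have "A = homothet (r / s) (x - (r / s) *\<^sub>R y) (homothet s y C)"
    using assms by (simp add: homothet_homothet)
  then show "is_homothet_of A (homothet s y C)"
    using A assms unfolding is_homothet_of_def by (metis divide_pos_pos)
qed

lemma non_degenerate_homothet:
  assumes "non_degenerate \<mu> C" "s > 0"
  shows "non_degenerate \<mu> (homothet s y C)"
  using assms by (simp add: non_degenerate_def homothet_homothet)

section \<open>Bounded asymmetry of convex bodies\<close>

lemma Helly_compact:
  fixes K :: "'i \<Rightarrow> 'a::euclidean_space set"
  assumes convex: "\<And>i. i \<in> I \<Longrightarrow> convex (K i)" and compact: "\<And>i. i \<in> I \<Longrightarrow> compact (K i)"
    and meet: "\<And>J. \<lbrakk>J \<subseteq> I; finite J; card J \<le> DIM('a) + 1\<rbrakk> \<Longrightarrow> \<Inter>(K ` J) \<noteq> {}"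
  shows "\<Inter>(K ` I) \<noteq> {}"
proof (cases "I = {}")
  case False
  then obtain i where i: "i \<in> I" by blast
  have small: "\<Inter>T \<noteq> {}" if T: "T \<subseteq> K ` I" "finite T" "card T \<le> DIM('a) + 1" for T
  proof -
    obtain J where "J \<subseteq> I" "inj_on K J" "T = K ` J"
      using T(1) unfolding subset_image_inj by blast
    then show ?thesis
      using meet[of J] T by (auto simp: finite_image_iff card_image)
  qed
  have finite_meet: "\<Inter>T \<noteq> {}" if T: "T \<subseteq> K ` I" "finite T" for T
  proof (cases "card T \<le> DIM('a) + 1")
    case False
    show ?thesis
    proof (rule Helly)
      show "\<forall>S\<in>T. convex S"
        using T convex by auto
      show "\<Inter>U \<noteq> {}" if "U \<subseteq> T" "card U = DIM('a) + 1" for U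
        using small[of U] that T finite_subset by fastforce
    qed (use False in auto)
  qed (use small T in auto)
  have "K i \<inter> \<Inter>(K ` J) \<noteq> {}" if "finite J" "J \<subseteq> I" for J
  proof -
    have "\<Inter>(K ` insert i J) \<noteq> {}"
      using that i by (intro finite_meet) auto
    then show ?thesis by simp
  qed
  then have "K i \<inter> \<Inter>(K ` I) \<noteq> {}"
    using compact i by (metis compact_imp_fip_image compact_imp_closed)
  then show ?thesis by blast
qed simp

lemma centroid_mem_homothet:
  fixes Y :: "'a::euclidean_space set"
  defines "s \<equiv> 1 - 1 / real (card Y)"
  assumes "convex C" "finite Y" "Y \<subseteq> C" "x \<in> Y"
  shows "\<Sum>Y /\<^sub>R real (card Y) \<in> homothet s (x - s *\<^sub>R x) C"
proof -
  define k where "k = real (card Y)"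
  have "k > 0"
    using assms by (auto simp: k_def card_gt_0_iff)
  have "\<Sum>(Y - {x}) \<in> homothet (k - 1) 0 C"
    using sum_mem_homothet[of C "Y - {x}"] assms \<open>k > 0\<close>
    by (auto simp: k_def card_Diff_singleton of_nat_diff)
  then obtain v where v: "v \<in> C" "\<Sum>(Y - {x}) = (k - 1) *\<^sub>R v"
    by (auto simp: mem_homothet)
  have "\<Sum>Y = x + (k - 1) *\<^sub>R v"
    using assms v(2) by (simp add: sum.remove)
  then have "\<Sum>Y /\<^sub>R k = ((k - 1) / k) *\<^sub>R v + (1 / k) *\<^sub>R x"
    by (simp add: scaleR_add_right divide_inverse_commute)
  also have "\<dots> = s *\<^sub>R v + (x - s *\<^sub>R x)"
    using \<open>k > 0\<close> by (simp add: s_def k_def[symmetric] diff_divide_distrib algebra_simps)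
  finally show ?thesis
    using v(1) by (auto simp: mem_homothet k_def)
qed

lemma reflect_mem_of_mem_shrunken:
  assumes "d > 0" "c \<in> homothet (d / (d + 1)) (x - (d / (d + 1)) *\<^sub>R x) C"
  shows "c - (x - c) /\<^sub>R d \<in> C"
proof -
  define s where "s = d / (d + 1)"
  obtain y where y: "y \<in> C" "c = s *\<^sub>R y + (x - s *\<^sub>R x)"
    using assms(2) unfolding s_def mem_homothet by blast
  have ratio: "(1 + 1 / d) * s = 1"
    using assms(1) by (simp add: s_def divide_simps)
  have "c - (x - c) /\<^sub>R d = (1 + 1 / d) *\<^sub>R c - (1 / d) *\<^sub>R x"
    by (simp add: algebra_simps divide_inverse)
  also have "(1 + 1 / d) *\<^sub>R c
      = ((1 + 1 / d) * s) *\<^sub>R y + (1 + 1 / d - (1 + 1 / d) * s) *\<^sub>R x"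
    unfolding y(2) by (simp add: scaleR_add_right scaleR_diff_right scaleR_diff_left)
  also have "\<dots> - (1 / d) *\<^sub>R x = y"
    unfolding ratio by simp
  finally show ?thesis
    using y(1) by simp
qed

text \<open>Shrunk towards their points by the factor \<open>d / (d + 1)\<close>, the copies of \<open>C\<close> have a centroid
  in common whenever there are at most \<open>d + 1\<close> of them, so Helly's theorem applies.\<close>

lemma exists_centre_of_bounded_asymmetry:
  fixes C :: "'a::euclidean_space set"
  assumes "convex C" "compact C"
  obtains c where "\<And>x. x \<in> C \<Longrightarrow> c - (x - c) /\<^sub>R real DIM('a) \<in> C"
proof -
  define d where "d = real DIM('a)"
  define s where "s = d / (d + 1)"
  have d: "d > 0" "s > 0" by (auto simp: d_def s_def add_pos_pos)
  define K where "K x = homothet s (x - s *\<^sub>R x) C" for x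
  have "\<Inter>(K ` C) \<noteq> {}"
  proof (rule Helly_compact)
    fix Y assume Y: "Y \<subseteq> C" "finite Y" "card Y \<le> DIM('a) + 1"
    have "\<Sum>Y /\<^sub>R real (card Y) \<in> K x" if "x \<in> Y" for x
    proof -
      define t where "t = 1 - 1 / real (card Y)"
      have "real (card Y) \<ge> 1" "real (card Y) \<le> d + 1"
        using Y that by (auto simp: d_def Suc_le_eq card_gt_0_iff)
      then have "0 \<le> t" "t \<le> s"
        using d by (auto simp: t_def s_def field_simps)
      then have "homothet t (x - t *\<^sub>R x) C \<subseteq> K x"
        unfolding K_def using assms Y that by (intro homothet_mono) auto
      then show ?thesis
        using centroid_mem_homothet[OF assms(1) Y(2,1) that] unfolding t_def by blast
    qed
    then show "\<Inter>(K ` Y) \<noteq> {}" by blast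
  qed (use assms in \<open>auto simp: K_def intro: convex_homothet compact_homothet\<close>)
  then obtain c where "\<And>x. x \<in> C \<Longrightarrow> c \<in> K x"
    by blast
  then have "c - (x - c) /\<^sub>R d \<in> C" if "x \<in> C" for x
    using reflect_mem_of_mem_shrunken[of d c x C] that d by (simp add: K_def s_def)
  then show thesis
    unfolding d_def by (rule that)
qed

lemma zero_mem_interior_of_bounded_asymmetry:
  fixes C :: "'a::euclidean_space set"
  assumes "convex C" "interior C \<noteq> {}" "n > 0" and reflect: "\<And>x. x \<in> C \<Longrightarrow> - (x /\<^sub>R n) \<in> C"
  shows "0 \<in> interior C"
proof -
  obtain z where z: "z \<in> interior C"
    using assms by blast
  define y where "y = - (z /\<^sub>R n)"
  define e where "e = 1 / (n + 1)"
  have "y \<in> C"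
    unfolding y_def using reflect z interior_subset by blast
  then have "y - e *\<^sub>R (y - z) \<in> interior C"
    using assms z by (intro mem_interior_convex_shrink) (auto simp: e_def)
  also have "y - e *\<^sub>R (y - z) = (e * (1 / n + 1) - 1 / n) *\<^sub>R z"
    by (simp add: y_def algebra_simps divide_inverse)
  also have "e * (1 / n + 1) - 1 / n = 0"
    using assms by (simp add: e_def divide_simps)
  finally show ?thesis by simp
qed

locale asymmetric_body =
  fixes C :: "'a::euclidean_space set" and n :: real
  assumes convex: "convex C" and compact: "compact C" and zero_mem_interior: "0 \<in> interior C"
    and n_ge_1: "1 \<le> n" and reflect: "x \<in> C \<Longrightarrow> - (x /\<^sub>R n) \<in> C"

lemma convex_body_translate_asymmetric:
  fixes C :: "'a::euclidean_space set"
  assumes "convex_body C"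
  obtains c where "asymmetric_body (homothet 1 (- c) C) (real DIM('a))"
proof -
  have C: "convex C" "compact C" "interior C \<noteq> {}"
    using assms by (auto simp: convex_body_def)
  obtain c where c: "\<And>x. x \<in> C \<Longrightarrow> c - (x - c) /\<^sub>R real DIM('a) \<in> C"
    using exists_centre_of_bounded_asymmetry C by blast
  define B where "B = homothet 1 (- c) C"
  have B: "convex B" "compact B"
    unfolding B_def using C convex_homothet compact_homothet by blast+
  have reflect: "- (x /\<^sub>R real DIM('a)) \<in> B" if "x \<in> B" for x
  proof -
    obtain u where u: "u \<in> C" "x = u - c"
      using \<open>x \<in> B\<close> by (auto simp: B_def mem_homothet)
    have "- (x /\<^sub>R real DIM('a)) = 1 *\<^sub>R (c - (u - c) /\<^sub>R real DIM('a)) + - c"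
      by (simp add: u(2))
    then show ?thesis
      using c[OF u(1)] unfolding B_def mem_homothet by blast
  qed
  have "B = (+) (- c) ` C"
    by (simp add: B_def homothet_def add.commute)
  then have "interior B \<noteq> {}"
    using C(3) by (metis interior_translation image_is_empty)
  then have "0 \<in> interior B"
    using B(1) reflect by (intro zero_mem_interior_of_bounded_asymmetry) auto
  then have "asymmetric_body B (real DIM('a))"
    using B reflect by unfold_locales (auto simp: Suc_le_eq)
  then show thesis
    using that by (simp add: B_def)
qed

section \<open>Homothets of prescribed measure\<close>

lemma eventually_mem_iff_of_notin_frontier:
  assumes "(f \<longlongrightarrow> p) F" "p \<notin> frontier S"
  shows "\<forall>\<^sub>F i in F. f i \<in> S \<longleftrightarrow> p \<in> S"
proof (cases "p \<in> S")
  case True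
  then have "p \<in> interior S"
    using assms(2) closure_subset by (auto simp: frontier_def)
  then have "\<forall>\<^sub>F i in F. f i \<in> interior S"
    using assms(1) by (intro topological_tendstoD) auto
  then show ?thesis
    by eventually_elim (use True interior_subset in auto)
next
  case False
  then have "p \<in> - closure S"
    using assms(2) interior_subset by (auto simp: frontier_def)
  then have "\<forall>\<^sub>F i in F. f i \<in> - closure S"
    using assms(1) by (intro topological_tendstoD) auto
  then show ?thesis
    by eventually_elim (use False closure_subset in auto)
qed

lemma eventually_mem_homothet_iff:
  assumes "s > 0" "(t \<longlongrightarrow> s) F" "p \<notin> frontier (homothet s x C)"
  shows "\<forall>\<^sub>F i in F. p \<in> homothet (t i) x C \<longleftrightarrow> p \<in> homothet s x C"
proof -
  have "((\<lambda>i. s *\<^sub>R ((p - x) /\<^sub>R t i) + x) \<longlongrightarrow> s *\<^sub>R ((p - x) /\<^sub>R s) + x) F"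
    using assms by (intro tendsto_intros) auto
  also have "s *\<^sub>R ((p - x) /\<^sub>R s) + x = p"
    using assms by simp
  finally have "\<forall>\<^sub>F i in F. s *\<^sub>R ((p - x) /\<^sub>R t i) + x \<in> homothet s x C \<longleftrightarrow> p \<in> homothet s x C"
    using assms(3) by (rule eventually_mem_iff_of_notin_frontier)
  moreover have "\<forall>\<^sub>F i in F. t i > 0"
    using assms by (intro order_tendstoD) auto
  ultimately show ?thesis
  proof eventually_elim
    case (elim i)
    have "s *\<^sub>R u + x \<in> homothet s x C \<longleftrightarrow> u \<in> C" for u
      using assms(1) by (auto simp: mem_homothet)
    then have "s *\<^sub>R ((p - x) /\<^sub>R t i) + x \<in> homothet s x C \<longleftrightarrow> p \<in> homothet (t i) x C"
      using elim(2) by (metis mem_homothet_iff less_irrefl)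
    then show ?case
      using elim(1) by simp
  qed
qed

lemma tendsto_emeasure_dominated:
  assumes sets: "\<And>n. S n \<in> sets M" "T \<in> sets M"
    and dominating: "D \<in> sets M" "emeasure M D < \<infinity>" "\<And>n. S n \<subseteq> D"
    and eventually: "AE p in M. \<forall>\<^sub>F n in sequentially. p \<in> S n \<longleftrightarrow> p \<in> T"
  shows "(\<lambda>n. emeasure M (S n)) \<longlonglongrightarrow> emeasure M T"
proof -
  have "AE p in M. (\<lambda>n. indicator (S n) p :: ennreal) \<longlonglongrightarrow> indicator T p"
    using eventually
  proof eventually_elim
    case (elim p)
    then have "\<forall>\<^sub>F n in sequentially. indicator T p = (indicator (S n) p :: ennreal)"
      by eventually_elim (auto simp: indicator_def)
    then show ?case
      by (rule Lim_transform_eventually[OF tendsto_const])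
  qed
  moreover have "indicator (S n) p \<le> (indicator D p :: ennreal)" for n p
    using dominating(3)[of n] by (auto simp: indicator_def)
  ultimately have "(\<lambda>n. \<integral>\<^sup>+p. indicator (S n) p \<partial>M) \<longlonglongrightarrow> (\<integral>\<^sup>+p. indicator T p \<partial>M)"
    using sets dominating(1,2)
    by (intro nn_integral_dominated_convergence[where w = "indicator D"]) auto
  then show ?thesis
    using sets by simp
qed

context
  fixes \<mu> :: "'a::euclidean_space measure"
  assumes lf: "locally_finite_borel \<mu>"
begin

lemma sets_locally_finite_borel: "sets \<mu> = sets borel"
  using lf by (simp add: locally_finite_borel_def)

lemma homothet_in_sets:
  assumes "compact C"
  shows "homothet r x C \<in> sets \<mu>"
  using borel_compact[OF compact_homothet[OF assms]] by (simp add: sets_locally_finite_borel)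

lemma emeasure_bounded_finite:
  assumes "bounded S"
  shows "emeasure \<mu> S < \<infinity>"
proof -
  have "emeasure \<mu> S \<le> emeasure \<mu> (closure S)"
    by (rule emeasure_mono) (auto simp: closure_subset sets_locally_finite_borel)
  also have "\<dots> < \<infinity>"
    using lf assms unfolding locally_finite_borel_def by (simp add: compact_closure)
  finally show ?thesis .
qed

lemma emeasure_singleton_eq_0:
  assumes "non_degenerate \<mu> C" "bounded C" "C \<noteq> {}"
  shows "emeasure \<mu> {x} = 0"
proof -
  obtain z where z: "z \<in> frontier C"
    using assms frontier_not_empty not_bounded_UNIV by (metis all_not_in_conv)
  have "homothet 1 (x - z) C = (+) (x - z) ` C"
    by (simp add: homothet_def add.commute)
  then have "x \<in> frontier (homothet 1 (x - z) C)"
    using z by (auto simp: frontier_translation intro!: image_eqI[of _ _ z])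
  then have "emeasure \<mu> {x} \<le> emeasure \<mu> (frontier (homothet 1 (x - z) C))"
    by (intro emeasure_mono) (auto simp: sets_locally_finite_borel)
  also have "\<dots> = 0"
    using assms by (simp add: non_degenerate_def)
  finally show ?thesis by simp
qed

lemma exists_ball_emeasure_less:
  assumes "emeasure \<mu> {x} = 0" "0 < m"
  obtains e where "e > 0" "emeasure \<mu> (ball x e) < m"
proof -
  define B where "B n = ball x (inverse (real (Suc n)))" for n
  have "B i \<subseteq> B j" if "j \<le> i" for i j
    unfolding B_def using that by (intro subset_ball) (simp add: field_simps)
  then have "decseq B"
    by (simp add: decseq_def)
  moreover have "emeasure \<mu> (B n) \<noteq> \<infinity>" for n
    using emeasure_bounded_finite[of "B n"] by (simp add: B_def)
  ultimately have "(\<lambda>n. emeasure \<mu> (B n)) \<longlonglongrightarrow> emeasure \<mu> (\<Inter>n. B n)"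
    using sets_locally_finite_borel by (intro Lim_emeasure_decseq) (auto simp: B_def[abs_def])
  also have "(\<Inter>n. B n) = {x}"
  proof -
    have "y = x" if "\<And>n. dist x y < inverse (real (Suc n))" for y
      using that reals_Archimedean[of "dist x y"] by (metis less_asym zero_less_dist_iff)
    then show ?thesis by (auto simp: B_def)
  qed
  finally have "\<forall>\<^sub>F n in sequentially. emeasure \<mu> (B n) < m"
    using assms by (intro order_tendstoD(2)) auto
  then obtain n where "emeasure \<mu> (B n) < m"
    by (auto simp: eventually_sequentially)
  then show thesis
    using that[of "inverse (real (Suc n))"] by (simp add: B_def)
qed

lemma exists_uniform_ball_emeasure_less:
  assumes "\<And>x. emeasure \<mu> {x} = 0" "bounded K" "0 < m"
  obtains \<epsilon> where "\<epsilon> > 0" "\<And>x. x \<in> K \<Longrightarrow> emeasure \<mu> (ball x \<epsilon>) < m"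
proof -
  have "\<exists>G. open G \<and> emeasure \<mu> G < m \<and> x \<in> G" for x
    using exists_ball_emeasure_less[OF assms(1,3)] by (metis centre_in_ball open_ball)
  then have "closure K \<subseteq> \<Union>{G. open G \<and> emeasure \<mu> G < m}"
    by blast
  then obtain \<epsilon> where \<epsilon>: "\<epsilon> > 0"
    "\<And>x. x \<in> closure K \<Longrightarrow> \<exists>G \<in> {G. open G \<and> emeasure \<mu> G < m}. ball x \<epsilon> \<subseteq> G"
    using assms(2) Heine_Borel_lemma[of "closure K" "{G. open G \<and> emeasure \<mu> G < m}"]
    unfolding compact_closure[symmetric] by (metis (no_types, lifting) mem_Collect_eq)
  have "emeasure \<mu> (ball x \<epsilon>) < m" if "x \<in> K" for x
  proof -
    obtain G where G: "open G" "emeasure \<mu> G < m" "ball x \<epsilon> \<subseteq> G"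
      using \<epsilon>(2) \<open>x \<in> K\<close> closure_subset by blast
    then have "emeasure \<mu> (ball x \<epsilon>) \<le> emeasure \<mu> G"
      by (intro emeasure_mono) (auto simp: sets_locally_finite_borel)
    then show ?thesis
      using G(2) by (rule le_less_trans)
  qed
  then show thesis
    using that \<epsilon>(1) by blast
qed

lemma exists_ball_emeasure_gt:
  assumes "emeasure \<mu> UNIV = \<infinity>" "m < \<infinity>"
  obtains k where "m < emeasure \<mu> (ball (0::'a) k)"
proof -
  have "(SUP n. emeasure \<mu> (ball (0::'a) (real n))) = emeasure \<mu> (\<Union>n. ball 0 (real n))"
    by (rule SUP_emeasure_incseq) (auto simp: sets_locally_finite_borel incseq_def)
  also have "(\<Union>n. ball 0 (real n)) = (UNIV :: 'a set)"
    using reals_Archimedean2 by auto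
  finally have "m < (SUP n. emeasure \<mu> (ball (0::'a) (real n)))"
    using assms by metis
  then show thesis
    using that by (auto simp: less_SUP_iff)
qed

lemma exists_uniform_cball_emeasure_gt:
  assumes "emeasure \<mu> UNIV = \<infinity>" "bounded K" "m < \<infinity>"
  obtains R where "\<And>x. x \<in> K \<Longrightarrow> m < emeasure \<mu> (cball x R)"
proof -
  obtain k where k: "m < emeasure \<mu> (ball (0::'a) k)"
    using assms exists_ball_emeasure_gt by blast
  obtain B where B: "\<And>x. x \<in> K \<Longrightarrow> norm x \<le> B"
    using assms(2) bounded_iff by metis
  have "m < emeasure \<mu> (cball x (k + B))" if "x \<in> K" for x
  proof -
    have "ball 0 k \<subseteq> cball x (k + B)"
      unfolding subset_iff using B[OF that] norm_triangle_ineq4[of x]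
      by (smt (verit, best) dist_norm mem_ball_0 mem_cball)
    then have "emeasure \<mu> (ball 0 k) \<le> emeasure \<mu> (cball x (k + B))"
      by (intro emeasure_mono) (auto simp: sets_locally_finite_borel)
    then show ?thesis
      using k by (rule less_le_trans[rotated])
  qed
  then show thesis using that by blast
qed

lemma tendsto_emeasure_homothet:
  assumes "compact C" "non_degenerate \<mu> C" "s > 0" "t \<longlonglongrightarrow> s" "\<And>n. t n > 0"
  shows "(\<lambda>n. emeasure \<mu> (homothet (t n) x C)) \<longlonglongrightarrow> emeasure \<mu> (homothet s x C)"
proof -
  obtain b where b: "b > 0" "C \<subseteq> cball 0 b"
    using bounded_subset_ballD[OF compact_imp_bounded[OF assms(1)], of 0] ball_subset_cball
    by (metis subset_trans)
  obtain T where T: "\<And>n. t n \<le> T"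
    using convergent_imp_Bseq[of t] assms(4) Bseq_def by (metis abs_le_D1 convergentI real_norm_def)
  show ?thesis
  proof (rule tendsto_emeasure_dominated)
    show "homothet (t n) x C \<subseteq> cball x (T * b)" for n
    proof -
      have "homothet (t n) x C \<subseteq> cball x (t n * b)"
        using b assms(5)[of n] by (intro homothet_subset_cball) auto
      also have "\<dots> \<subseteq> cball x (T * b)"
        using T b by (intro subset_cball mult_right_mono) auto
      finally show ?thesis .
    qed
    have "emeasure \<mu> (frontier (homothet s x C)) = 0"
      using assms by (simp add: non_degenerate_def)
    then have "AE p in \<mu>. p \<notin> frontier (homothet s x C)"
      by (intro AE_not_in) (auto simp: null_sets_def sets_locally_finite_borel)
    then show "AE p in \<mu>. \<forall>\<^sub>F n in sequentially. p \<in> homothet (t n) x C \<longleftrightarrow> p \<in> homothet s x C"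
      by eventually_elim (rule eventually_mem_homothet_iff[OF assms(3,4)])
  qed (use homothet_in_sets[OF assms(1)] emeasure_bounded_finite in
      \<open>auto simp: sets_locally_finite_borel\<close>)
qed

lemma continuous_on_emeasure_homothet:
  assumes "compact C" "non_degenerate \<mu> C"
  shows "continuous_on {0<..} (\<lambda>r. emeasure \<mu> (homothet r x C))"
  using assms by (intro continuous_on_sequentiallyI tendsto_emeasure_homothet) auto

lemma exists_radius_emeasure_homothet_less:
  assumes "bounded C" "C \<noteq> {}" "non_degenerate \<mu> C" "bounded K" "0 < m"
  obtains \<rho> where "0 < \<rho>"
    "\<And>x r. \<lbrakk>x \<in> K; 0 < r; r \<le> \<rho>\<rbrakk> \<Longrightarrow> emeasure \<mu> (homothet r x C) < m"
proof -
  obtain b where b: "b > 0" "C \<subseteq> cball 0 b"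
    using bounded_subset_ballD[OF assms(1), of 0] ball_subset_cball by (metis subset_trans)
  obtain \<epsilon> where \<epsilon>: "\<epsilon> > 0" "\<And>x. x \<in> K \<Longrightarrow> emeasure \<mu> (ball x \<epsilon>) < m"
    using exists_uniform_ball_emeasure_less[OF emeasure_singleton_eq_0[OF assms(3,1,2)] assms(4,5)]
    by blast
  show thesis
  proof
    show "\<epsilon> / (2 * b) > 0"
      using \<epsilon>(1) b(1) by simp
    fix x r assume x: "x \<in> K" and r: "0 < r" "r \<le> \<epsilon> / (2 * b)"
    have "homothet r x C \<subseteq> cball x (r * b)"
      using b r by (intro homothet_subset_cball) auto
    also have "r * b < \<epsilon>"
      using r b(1) \<epsilon>(1) by (simp add: field_simps)
    then have "cball x (r * b) \<subseteq> ball x \<epsilon>"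
      by auto
    finally have "emeasure \<mu> (homothet r x C) \<le> emeasure \<mu> (ball x \<epsilon>)"
      by (rule emeasure_mono) (simp add: sets_locally_finite_borel)
    then show "emeasure \<mu> (homothet r x C) < m"
      using \<epsilon>(2)[OF x] by (rule le_less_trans)
  qed
qed

lemma exists_radius_emeasure_homothet_gt:
  assumes "compact C" "0 \<in> interior C" "emeasure \<mu> UNIV = \<infinity>" "bounded K" "m < \<infinity>"
  obtains R where "\<And>x r. \<lbrakk>x \<in> K; 0 < r; R \<le> r\<rbrakk> \<Longrightarrow> m < emeasure \<mu> (homothet r x C)"
proof -
  obtain e where e: "e > 0" "cball 0 e \<subseteq> C"
    using assms(2) mem_interior_cball by blast
  obtain T where T: "\<And>x. x \<in> K \<Longrightarrow> m < emeasure \<mu> (cball x T)"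
    using exists_uniform_cball_emeasure_gt assms(3-5) by metis
  show thesis
  proof
    fix x r assume x: "x \<in> K" and r: "0 < r" "T / e \<le> r"
    have "cball x T \<subseteq> cball x (r * e)"
      using e(1) r(2) by (intro subset_cball) (simp add: field_simps)
    also have "\<dots> \<subseteq> homothet r x C"
      using e r by (intro cball_subset_homothet)
    finally have "emeasure \<mu> (cball x T) \<le> emeasure \<mu> (homothet r x C)"
      using homothet_in_sets[OF assms(1)] by (rule emeasure_mono)
    then show "m < emeasure \<mu> (homothet r x C)"
      using T[OF x] by (rule less_le_trans[rotated])
  qed
qed

lemma exists_homothet_radii:
  assumes "compact C" "0 \<in> interior C" "non_degenerate \<mu> C" "emeasure \<mu> UNIV = \<infinity>"
    and "bounded K" "0 < m" "m < \<infinity>"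
  obtains \<rho> r R where "0 < \<rho>" "\<And>x. x \<in> K \<Longrightarrow> \<rho> \<le> r x" "\<And>x. x \<in> K \<Longrightarrow> r x \<le> R"
    "\<And>x. x \<in> K \<Longrightarrow> emeasure \<mu> (homothet (r x) x C) = m"
proof -
  have "bounded C" "C \<noteq> {}"
    using assms(1,2) interior_subset compact_imp_bounded by auto
  then obtain \<rho> where \<rho>: "0 < \<rho>"
    "\<And>x r. \<lbrakk>x \<in> K; 0 < r; r \<le> \<rho>\<rbrakk> \<Longrightarrow> emeasure \<mu> (homothet r x C) < m"
    using exists_radius_emeasure_homothet_less assms(3,5,6) by metis
  obtain T where T: "\<And>x r. \<lbrakk>x \<in> K; 0 < r; T \<le> r\<rbrakk> \<Longrightarrow> m < emeasure \<mu> (homothet r x C)"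
    using exists_radius_emeasure_homothet_gt[OF assms(1,2,4,5,7)] by metis
  define R where "R = max \<rho> T"
  have "\<exists>r\<ge>\<rho>. r \<le> R \<and> emeasure \<mu> (homothet r x C) = m" if "x \<in> K" for x
  proof (rule IVT')
    show "emeasure \<mu> (homothet \<rho> x C) \<le> m" "m \<le> emeasure \<mu> (homothet R x C)" "\<rho> \<le> R"
      using \<rho> T[of x R] that by (auto simp: R_def intro: less_imp_le)
    show "continuous_on {\<rho>..R} (\<lambda>r. emeasure \<mu> (homothet r x C))"
      by (rule continuous_on_subset[OF continuous_on_emeasure_homothet])
        (use assms \<rho>(1) in auto)
  qed
  then show thesis
    using that \<rho>(1) by metis
qed

end

section \<open>Greedy selection\<close>

definition precedes :: "real \<Rightarrow> ('a \<Rightarrow> real) \<Rightarrow> ('a \<Rightarrow> 'a set) \<Rightarrow> 'a \<Rightarrow> 'a \<Rightarrow> bool" where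
  "precedes q r H x y \<longleftrightarrow> r y \<le> q * r x \<and> y \<notin> H x"

inductive greedy_selection ::
  "real \<Rightarrow> ('a \<Rightarrow> real) \<Rightarrow> ('a \<Rightarrow> 'a set) \<Rightarrow> 'a set \<Rightarrow> 'a set \<Rightarrow> bool"
  for q r H K where
  empty: "greedy_selection q r H K {}"
| insert: "greedy_selection q r H K (insert y X)"
  if "greedy_selection q r H K X" "y \<in> K - \<Union>(H ` X)"
    "\<And>z. z \<in> K - \<Union>(H ` X) \<Longrightarrow> r z \<le> q * r y"

lemma greedy_selection_finite_subset:
  assumes "greedy_selection q r H K X"
  shows "finite X" "X \<subseteq> K"
  using assms by (induction; simp)+

lemma greedy_selection_precedes_uncovered:
  assumes "greedy_selection q r H K X" "x \<in> X" "y \<in> K - \<Union>(H ` X)"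
  shows "precedes q r H x y"
  using assms by (induction arbitrary: x y) (auto simp: precedes_def)

lemma greedy_selection_pairwise:
  assumes "greedy_selection q r H K X"
  shows "pairwise (symclp (precedes q r H)) X"
  using assms
proof induction
  case empty
  show ?case by simp
next
  case (insert X y)
  have "precedes q r H x y" if "x \<in> X" for x
    using insert.hyps(1) that insert.hyps(2) by (rule greedy_selection_precedes_uncovered)
  then show ?case
    using insert.IH by (auto simp: pairwise_insert)
qed

lemma exists_almost_maximal:
  fixes r :: "'a \<Rightarrow> real"
  assumes "S \<noteq> {}" "\<And>x. x \<in> S \<Longrightarrow> 0 < r x" "bdd_above (r ` S)" "1 < q"
  obtains y where "y \<in> S" "\<And>z. z \<in> S \<Longrightarrow> r z \<le> q * r y"
proof -
  define s where "s = Sup (r ` S)"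
  have le_s: "r z \<le> s" if "z \<in> S" for z
    unfolding s_def using that assms(3) by (intro cSup_upper) auto
  then have "s > 0"
    using assms(1,2) by (meson ex_in_conv less_le_trans)
  then have "s / q < s"
    using assms(4) by (simp add: field_simps)
  then obtain y where y: "y \<in> S" "s / q < r y"
    using less_cSup_iff[OF _ assms(3), of "s / q"] assms(1) unfolding s_def by auto
  then have "s < q * r y"
    using assms(4) by (simp add: field_simps)
  then have "r z \<le> q * r y" if "z \<in> S" for z
    using le_s[OF that] by simp
  then show thesis
    using that y(1) by blast
qed

lemma exists_greedy_cover:
  fixes r :: "'a \<Rightarrow> real"
  assumes "\<And>x. x \<in> K \<Longrightarrow> x \<in> H x" "\<And>x. x \<in> K \<Longrightarrow> 0 < r x" "bdd_above (r ` K)" "1 < q"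
    and card_le: "\<And>X. \<lbrakk>X \<subseteq> K; pairwise (symclp (precedes q r H)) X\<rbrakk> \<Longrightarrow> card X \<le> N"
  obtains X where "finite X" "X \<subseteq> K" "K \<subseteq> \<Union>(H ` X)" "pairwise (symclp (precedes q r H)) X"
proof -
  have "card X < Suc N" if "greedy_selection q r H K X" for X
    using card_le[OF greedy_selection_finite_subset(2)[OF that] greedy_selection_pairwise[OF that]]
    by simp
  then obtain X where X: "greedy_selection q r H K X"
    and maximal: "\<And>Y. greedy_selection q r H K Y \<Longrightarrow> card Y \<le> card X"
    using ex_has_greatest_nat[of "greedy_selection q r H K" "{}" card "Suc N"]
      greedy_selection.empty by metis
  have "K - \<Union>(H ` X) = {}"
  proof (rule ccontr)
    assume "K - \<Union>(H ` X) \<noteq> {}"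
    moreover have "bdd_above (r ` (K - \<Union>(H ` X)))"
      using assms(3) by (rule bdd_above_mono) auto
    ultimately obtain y where y: "y \<in> K - \<Union>(H ` X)"
      "\<And>z. z \<in> K - \<Union>(H ` X) \<Longrightarrow> r z \<le> q * r y"
      using exists_almost_maximal[of "K - \<Union>(H ` X)" r q] assms(2,4) by blast
    then have "y \<notin> X"
      using assms(1) by blast
    then have "card (insert y X) = Suc (card X)"
      using greedy_selection_finite_subset(1)[OF X] by simp
    then show False
      using maximal[OF greedy_selection.insert[OF X y]] by simp
  qed
  then show thesis
    using that[of X] greedy_selection_finite_subset[OF X] greedy_selection_pairwise[OF X] by blast
qed

lemma bounded_imp_card_separated_le:
  fixes K :: "'a::heine_borel set"
  assumes "bounded K" "d > 0"
  obtains N where "\<And>X. \<lbrakk>X \<subseteq> K; pairwise (\<lambda>x y. d \<le> dist x y) X\<rbrakk> \<Longrightarrow> card X \<le> N"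
proof -
  obtain T where T: "finite T" "closure K \<subseteq> (\<Union>t\<in>T. ball t (d / 2))"
    using assms compact_closure[of K] unfolding compact_eq_totally_bounded
    by (meson half_gt_zero)
  have "card X \<le> card T" if X: "X \<subseteq> K" "pairwise (\<lambda>x y. d \<le> dist x y) X" for X
  proof -
    have "\<forall>x\<in>X. \<exists>t\<in>T. dist t x < d / 2"
      using X(1) T(2) closure_subset by (fastforce simp: subset_iff)
    then obtain g where g: "\<And>x. x \<in> X \<Longrightarrow> g x \<in> T" "\<And>x. x \<in> X \<Longrightarrow> dist (g x) x < d / 2"
      by metis
    have "inj_on g X"
    proof (rule inj_onI, rule ccontr)
      fix x y assume xy: "x \<in> X" "y \<in> X" "g x = g y" "x \<noteq> y"
      then have "dist x y < d"
        using g(2)[of x] g(2)[of y] dist_triangle3[of x y "g x"] by simp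
      then show False
        using X(2) xy unfolding pairwise_def by fastforce
    qed
    then show ?thesis
      using g(1) T(1) by (intro card_inj_on_le[of g]) auto
  qed
  then show thesis using that by blast
qed

section \<open>Multiplicity of greedily selected homothets\<close>

definition multiplicity_le :: "'a set set \<Rightarrow> real \<Rightarrow> bool" where
  "multiplicity_le \<F> c \<longleftrightarrow>
     (\<forall>p. finite {A \<in> \<F>. p \<in> A} \<and> real (card {A \<in> \<F>. p \<in> A}) \<le> c)"

lemma multiplicity_le_image:
  assumes "finite X" "\<And>p. real (card {x \<in> X. p \<in> H x}) \<le> c"
  shows "multiplicity_le (H ` X) c"
  unfolding multiplicity_le_def
proof (intro allI conjI)
  fix p
  have "{A \<in> H ` X. p \<in> A} = H ` {x \<in> X. p \<in> H x}"
    by auto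
  then have "card {A \<in> H ` X. p \<in> A} \<le> card {x \<in> X. p \<in> H x}"
    using assms(1) by (simp add: card_image_le)
  then show "real (card {A \<in> H ` X. p \<in> A}) \<le> c"
    using assms(2)[of p] by linarith
qed (use assms(1) in simp)

lemma multiplicity_le_subset:
  assumes "multiplicity_le \<F> c" "\<G> \<subseteq> \<F>"
  shows "multiplicity_le \<G> c"
  unfolding multiplicity_le_def
proof (intro allI conjI)
  fix p
  have subset: "{A \<in> \<G>. p \<in> A} \<subseteq> {A \<in> \<F>. p \<in> A}" and finite_superset: "finite {A \<in> \<F>. p \<in> A}"
    using assms by (auto simp: multiplicity_le_def)
  show "finite {A \<in> \<G>. p \<in> A}"
    using subset finite_superset by (rule finite_subset)
  have "card {A \<in> \<G>. p \<in> A} \<le> card {A \<in> \<F>. p \<in> A}"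
    using finite_superset subset by (rule card_mono)
  also have "real (card {A \<in> \<F>. p \<in> A}) \<le> c"
    using assms(1) by (simp add: multiplicity_le_def)
  finally show "real (card {A \<in> \<G>. p \<in> A}) \<le> c"
    by simp
qed

lemma card_disjoint_homothets_le:
  fixes C :: "'a::euclidean_space set"
  assumes compact: "compact C" and interior: "interior C \<noteq> {}"
    and "finite V" and \<delta>: "0 < \<delta>" and t: "0 \<le> t"
    and disjoint: "disjoint_family_on (\<lambda>v. homothet \<delta> v C) V"
    and subset: "\<And>v. v \<in> V \<Longrightarrow> homothet \<delta> v C \<subseteq> homothet t x C"
  shows "real (card V) \<le> (t / \<delta>) ^ DIM('a)"
proof -
  have lmeasurable: "homothet r y C \<in> lmeasurable" for r y
    using compact by (intro lmeasurable_compact compact_homothet)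
  have "\<not> negligible C"
    using interior interior_subset open_interior by (metis negligible_subset open_not_negligible)
  then have pos: "measure lebesgue C > 0"
    using compact by (metis lmeasurable_compact measure_nonneg negligible_iff_measure order_le_less)
  have "real (card V) * (\<delta> ^ DIM('a) * measure lebesgue C)
      = (\<Sum>v\<in>V. measure lebesgue (homothet \<delta> v C))"
    using \<delta> by (simp add: measure_lebesgue_homothet)
  also have "\<dots> = measure lebesgue (\<Union>v\<in>V. homothet \<delta> v C)"
  proof (rule measure_finite_Union[symmetric])
    show "(\<lambda>v. homothet \<delta> v C) ` V \<subseteq> sets lebesgue"
      using lmeasurable fmeasurableD by blast
    show "emeasure lebesgue (homothet \<delta> v C) \<noteq> \<infinity>" for v
      using fmeasurableD2[OF lmeasurable] by simp
  qed (use \<open>finite V\<close> disjoint in auto)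
  also have "\<dots> \<le> measure lebesgue (homothet t x C)"
    using \<open>finite V\<close> subset lmeasurable
    by (intro measure_mono_fmeasurable) (auto simp: fmeasurableD)
  also have "\<dots> = t ^ DIM('a) * measure lebesgue C"
    using t by (rule measure_lebesgue_homothet)
  finally show ?thesis
    using pos \<delta> by (simp add: power_divide field_simps)
qed

context asymmetric_body
begin

lemma zero_mem: "0 \<in> C"
  using zero_mem_interior interior_subset by blast

lemma centre_mem: "x \<in> homothet r x C"
  using zero_mem by (auto simp: mem_homothet intro!: bexI[of _ 0])

lemma homothet_mono_radius: "\<lbrakk>0 \<le> r; r \<le> s\<rbrakk> \<Longrightarrow> homothet r x C \<subseteq> homothet s x C"
  using homothet_mono[OF convex zero_mem, of r s x] by simp

lemma uminus_mem_homothet: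
  assumes "p \<in> homothet s 0 C"
  shows "- p \<in> homothet (n * s) 0 C"
proof -
  obtain v where v: "v \<in> C" "p = s *\<^sub>R v"
    using assms by (auto simp: mem_homothet)
  have "- p = (n * s) *\<^sub>R (- (v /\<^sub>R n)) + 0"
    using n_ge_1 by (simp add: v(2))
  then show ?thesis
    using reflect[OF v(1)] unfolding mem_homothet by blast
qed

lemma radius_ratio_bounds:
  assumes "0 < r" "s \<le> (1 + 1 / (2 * n)) * r"
  shows "n * (s - r) \<le> r / 2" "s \<le> (3 / 2) * r"
proof -
  have "n * s \<le> (n + 1 / 2) * r"
    using assms(2) n_ge_1 by (simp add: field_simps)
  then show shrink: "n * (s - r) \<le> r / 2"
    by (simp add: algebra_simps)
  show "s \<le> (3 / 2) * r"
  proof (cases "r < s")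
    case True
    then have "1 * (s - r) \<le> n * (s - r)"
      using n_ge_1 by (intro mult_right_mono) auto
    also have "\<dots> \<le> r / 2"
      by (rule shrink)
    finally show ?thesis by simp
  qed (use assms(1) in simp)
qed

lemma radius_diff_scaleR_mem:
  assumes "v \<in> C" "0 < r" "0 < s" "s \<le> (1 + 1 / (2 * n)) * r"
  shows "(r - s) *\<^sub>R v \<in> homothet (r - s / 4) 0 C"
proof (cases "s \<le> r")
  case True
  have "(r - s) *\<^sub>R v \<in> homothet (r - s) 0 C"
    using assms(1) by (auto simp: mem_homothet)
  also have "\<dots> \<subseteq> homothet (r - s / 4) 0 C"
    using True assms(3) by (intro homothet_mono_radius) auto
  finally show ?thesis .
next
  case False
  have "(s - r) *\<^sub>R v \<in> homothet (s - r) 0 C"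
    using assms(1) by (auto simp: mem_homothet)
  then have "- ((s - r) *\<^sub>R v) \<in> homothet (n * (s - r)) 0 C"
    by (rule uminus_mem_homothet)
  also have "\<dots> \<subseteq> homothet (r - s / 4) 0 C"
    using False n_ge_1 radius_ratio_bounds[OF assms(2,4)] assms(2)
    by (intro homothet_mono_radius) auto
  finally show ?thesis
    by (simp add: scaleR_diff_left)
qed

text \<open>If \<open>v = w\<close>, then the second homothet is the image of the first under a homothety with
  centre \<open>p\<close>, a point of the first; so its centre lies in the first homothet. The tolerances on
  \<open>v - w\<close> and \<open>s\<close> are chosen such that \<open>n (s - r) + s / 4 \<le> r\<close>.\<close>

lemma centre_mem_of_close_directions:
  assumes v: "v \<in> C" and close: "v - w \<in> homothet (1 / 4) 0 C"
    and radii: "0 < r" "0 < s" "s \<le> (1 + 1 / (2 * n)) * r"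
    and p: "p = r *\<^sub>R v + x" "p = s *\<^sub>R w + y"
  shows "y \<in> homothet r x C"
proof -
  have "(r - s) *\<^sub>R v \<in> homothet (r - s / 4) 0 C"
    using v radii by (intro radius_diff_scaleR_mem) auto
  moreover have "s *\<^sub>R (v - w) \<in> homothet (s / 4) 0 C"
    using close by (auto simp: mem_homothet)
  ultimately have "(r - s) *\<^sub>R v + s *\<^sub>R (v - w) \<in> homothet (r - s / 4 + s / 4) (0 + 0) C"
    using radius_ratio_bounds(2)[OF radii(1,3)] radii(1,2)
    by (intro homothet_add_mem convex) auto
  moreover have "(r - s) *\<^sub>R v + s *\<^sub>R (v - w) = y - x"
    using p by (simp add: algebra_simps)
  ultimately show ?thesis
    by (auto simp: mem_homothet diff_eq_eq)
qed

lemma diff_mem_of_homothets_meet: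
  assumes "homothet \<delta> v C \<inter> homothet \<delta> w C \<noteq> {}" "0 \<le> \<delta>"
  shows "v - w \<in> homothet ((n + 1) * \<delta>) 0 C"
proof -
  obtain a b where ab: "a \<in> C" "b \<in> C" "\<delta> *\<^sub>R a + v = \<delta> *\<^sub>R b + w"
    using assms(1) by (force simp: mem_homothet)
  have "\<delta> *\<^sub>R u \<in> homothet \<delta> 0 C" if "u \<in> C" for u
    using that by (auto simp: mem_homothet)
  then have "\<delta> *\<^sub>R b \<in> homothet \<delta> 0 C" "- (\<delta> *\<^sub>R a) \<in> homothet (n * \<delta>) 0 C"
    using ab uminus_mem_homothet by blast+
  then have "\<delta> *\<^sub>R b + - (\<delta> *\<^sub>R a) \<in> homothet (\<delta> + n * \<delta>) (0 + 0) C"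
    using n_ge_1 assms(2) by (intro homothet_add_mem convex) auto
  moreover have "v - w = \<delta> *\<^sub>R b + - (\<delta> *\<^sub>R a)"
    using ab(3) by (simp add: algebra_simps)
  ultimately show ?thesis
    by (simp add: distrib_right add.commute)
qed

abbreviation selected_before :: "('a \<Rightarrow> real) \<Rightarrow> 'a \<Rightarrow> 'a \<Rightarrow> bool" where
  "selected_before r \<equiv> precedes (1 + 1 / (2 * n)) r (\<lambda>x. homothet (r x) x C)"

lemma directions_disjoint:
  assumes "symclp (selected_before r) x y" "0 < r x" "0 < r y"
    and "p \<in> homothet (r x) x C" "p \<in> homothet (r y) y C"
  shows "homothet (1 / (4 * (n + 1))) ((p - x) /\<^sub>R r x) C
    \<inter> homothet (1 / (4 * (n + 1))) ((p - y) /\<^sub>R r y) C = {}"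
proof -
  have "homothet (1 / (4 * (n + 1))) ((p - x) /\<^sub>R r x) C
      \<inter> homothet (1 / (4 * (n + 1))) ((p - y) /\<^sub>R r y) C = {}"
    if "selected_before r x y" and "0 < r x" "0 < r y" and "p \<in> homothet (r x) x C" for x y
  proof (rule ccontr)
    assume "\<not> ?thesis"
    then have "(p - x) /\<^sub>R r x - (p - y) /\<^sub>R r y
        \<in> homothet ((n + 1) * (1 / (4 * (n + 1)))) 0 C"
      using n_ge_1 by (intro diff_mem_of_homothets_meet) auto
    also have "(n + 1) * (1 / (4 * (n + 1))) = 1 / 4"
      using n_ge_1 by simp
    finally have "y \<in> homothet (r x) x C"
      using that by (intro centre_mem_of_close_directions[where r = "r x" and s = "r y" and p = p])
        (auto simp: mem_homothet_iff precedes_def)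
    then show False
      using \<open>selected_before r x y\<close> by (simp add: precedes_def)
  qed
  then show ?thesis
    using assms unfolding symclp_def by blast
qed

lemma card_selected_containing_le:
  assumes "finite X" "\<And>x. x \<in> X \<Longrightarrow> 0 < r x" "pairwise (symclp (selected_before r)) X"
  shows "real (card {x \<in> X. p \<in> homothet (r x) x C}) \<le> (4 * n + 5) ^ DIM('a)"
proof -
  define \<delta> where "\<delta> = 1 / (4 * (n + 1))"
  define Z where "Z = {x \<in> X. p \<in> homothet (r x) x C}"
  define v where "v x = (p - x) /\<^sub>R r x" for x
  have "\<delta> > 0"
    using n_ge_1 by (simp add: \<delta>_def)
  have v_mem: "v x \<in> C" if "x \<in> Z" for x
    using that assms(2)[of x] by (auto simp: Z_def v_def mem_homothet_iff)
  have disjoint: "homothet \<delta> (v x) C \<inter> homothet \<delta> (v y) C = {}"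
    if "x \<in> Z" "y \<in> Z" "x \<noteq> y" for x y
    unfolding v_def \<delta>_def using that assms
    by (intro directions_disjoint) (auto simp: Z_def pairwise_def)
  then have "inj_on v Z"
    by (intro inj_onI) (metis Int_absorb centre_mem empty_iff)
  then have "real (card Z) = real (card (v ` Z))"
    by (simp add: card_image)
  also have "\<dots> \<le> ((1 + \<delta>) / \<delta>) ^ DIM('a)"
  proof (rule card_disjoint_homothets_le[OF compact])
    show "disjoint_family_on (\<lambda>u. homothet \<delta> u C) (v ` Z)"
      using disjoint by (fastforce simp: disjoint_family_on_def)
    show "homothet \<delta> u C \<subseteq> homothet (1 + \<delta>) 0 C" if "u \<in> v ` Z" for u
      using that v_mem \<open>\<delta> > 0\<close> by (intro homothet_subset_of_mem convex) auto
  qed (use assms(1) \<open>\<delta> > 0\<close> zero_mem_interior in \<open>auto simp: Z_def\<close>)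
  also have "(1 + \<delta>) / \<delta> = 4 * n + 5"
    using n_ge_1 by (simp add: \<delta>_def field_simps)
  finally show ?thesis
    by (simp add: Z_def)
qed

end

section \<open>Coverings of bounded sets\<close>

definition homothets_of_measure ::
  "'a::euclidean_space measure \<Rightarrow> 'a set \<Rightarrow> ennreal \<Rightarrow> 'a set set" where
  "homothets_of_measure \<mu> C m = {A. is_homothet_of A C \<and> emeasure \<mu> A = m}"

definition covers_bounded_sets :: "'a::euclidean_space set set \<Rightarrow> real \<Rightarrow> bool" where
  "covers_bounded_sets \<A> c \<longleftrightarrow>
     (\<forall>K. bounded K \<longrightarrow> (\<exists>\<F>\<subseteq>\<A>. finite \<F> \<and> K \<subseteq> \<Union>\<F> \<and> (\<forall>A\<in>\<F>. A \<inter> K \<noteq> {}) \<and> multiplicity_le \<F> c))"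

context asymmetric_body
begin

lemma dist_ge_of_selected_before:
  assumes "symclp (selected_before r) x y" "0 < \<rho>" "\<rho> \<le> r x" "\<rho> \<le> r y" "cball 0 e \<subseteq> C" "0 < e"
  shows "\<rho> * e \<le> dist x y"
proof -
  have "\<rho> * e \<le> dist a b" if "selected_before r a b" "\<rho> \<le> r a" for a b
  proof -
    have "cball a (r a * e) \<subseteq> homothet (r a) a C"
      using that assms by (intro cball_subset_homothet) auto
    then have "b \<notin> cball a (r a * e)"
      using that(1) by (auto simp: precedes_def)
    moreover have "\<rho> * e \<le> r a * e"
      using that(2) assms by simp
    ultimately show ?thesis by simp
  qed
  from this[of x y] this[of y x] show ?thesis
    using assms(1,3,4) by (auto simp: symclp_def dist_commute)
qed

lemma card_selected_bounded:
  assumes "bounded K" "0 < \<rho>" "\<And>x. x \<in> K \<Longrightarrow> \<rho> \<le> r x"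
  obtains N where "\<And>X. \<lbrakk>X \<subseteq> K; pairwise (symclp (selected_before r)) X\<rbrakk> \<Longrightarrow> card X \<le> N"
proof -
  obtain e where e: "e > 0" "cball 0 e \<subseteq> C"
    using zero_mem_interior mem_interior_cball by blast
  obtain N where N: "\<And>X. \<lbrakk>X \<subseteq> K; pairwise (\<lambda>x y. \<rho> * e \<le> dist x y) X\<rbrakk> \<Longrightarrow> card X \<le> N"
    using bounded_imp_card_separated_le[OF assms(1), of "\<rho> * e"] assms(2) e(1) by auto
  have "card X \<le> N" if "X \<subseteq> K" "pairwise (symclp (selected_before r)) X" for X
  proof (rule N[OF that(1)])
    show "pairwise (\<lambda>x y. \<rho> * e \<le> dist x y) X"
      unfolding pairwise_def
    proof (intro ballI impI)
      fix x y assume "x \<in> X" "y \<in> X" "x \<noteq> y"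
      then have "symclp (selected_before r) x y" "\<rho> \<le> r x" "\<rho> \<le> r y"
        using that assms(3) by (auto simp: pairwise_def)
      then show "\<rho> * e \<le> dist x y"
        using assms(2) e by (intro dist_ge_of_selected_before)
    qed
  qed
  then show thesis using that by blast
qed

lemma covers_bounded_sets_homothets_of_measure:
  assumes lf: "locally_finite_borel \<mu>" and "non_degenerate \<mu> C" "emeasure \<mu> UNIV = \<infinity>"
    and "0 < m" "m < \<infinity>"
  shows "covers_bounded_sets (homothets_of_measure \<mu> C m) ((4 * n + 5) ^ DIM('a))"
  unfolding covers_bounded_sets_def
proof (intro allI impI)
  fix K :: "'a set" assume "bounded K"
  obtain \<rho> r R where r: "0 < \<rho>" "\<And>x. x \<in> K \<Longrightarrow> \<rho> \<le> r x" "\<And>x. x \<in> K \<Longrightarrow> r x \<le> R"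
    "\<And>x. x \<in> K \<Longrightarrow> emeasure \<mu> (homothet (r x) x C) = m"
    by (rule exists_homothet_radii[OF lf compact zero_mem_interior assms(2,3)
          \<open>bounded K\<close> assms(4,5)]) (rule that)
  have pos: "0 < r x" if "x \<in> K" for x
    using r(1) r(2)[OF that] by simp
  let ?H = "\<lambda>x. homothet (r x) x C"
  have admissible: "?H x \<in> homothets_of_measure \<mu> C m" if "x \<in> K" for x
    unfolding homothets_of_measure_def is_homothet_of_def using r(4)[OF that] pos[OF that] by blast
  obtain N where N: "\<And>X. \<lbrakk>X \<subseteq> K; pairwise (symclp (selected_before r)) X\<rbrakk> \<Longrightarrow> card X \<le> N"
    using card_selected_bounded[of K \<rho> r, OF \<open>bounded K\<close> r(1,2)] by blast
  have "bdd_above (r ` K)"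
    using r(3) by (intro bdd_aboveI[of _ R]) auto
  then obtain X where X: "finite X" "X \<subseteq> K" "K \<subseteq> \<Union>(?H ` X)"
    "pairwise (symclp (selected_before r)) X"
    using exists_greedy_cover[of K ?H r "1 + 1 / (2 * n)" N] centre_mem pos n_ge_1 N by auto
  show "\<exists>\<F>\<subseteq>homothets_of_measure \<mu> C m. finite \<F> \<and> K \<subseteq> \<Union>\<F> \<and> (\<forall>A\<in>\<F>. A \<inter> K \<noteq> {})
      \<and> multiplicity_le \<F> ((4 * n + 5) ^ DIM('a))"
  proof (intro exI[of _ "?H ` X"] conjI ballI)
    show "?H ` X \<subseteq> homothets_of_measure \<mu> C m"
      using X(2) admissible by blast
    show "A \<inter> K \<noteq> {}" if "A \<in> ?H ` X" for A
      using that X(2) centre_mem by blast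
    show "multiplicity_le (?H ` X) ((4 * n + 5) ^ DIM('a))"
      using X pos
      by (intro multiplicity_le_image card_selected_containing_le) auto
  qed (use X in auto)
qed

end

section \<open>Coverings of the space by shells\<close>

lemma sum_emeasure_le_multiplicity:
  assumes "finite \<F>" and sets: "\<F> \<subseteq> sets M" "D \<in> sets M"
    and subset: "\<And>A. A \<in> \<F> \<Longrightarrow> A \<subseteq> D" and multiplicity: "multiplicity_le \<F> c"
  shows "(\<Sum>A\<in>\<F>. emeasure M A) \<le> ennreal c * emeasure M D"
proof -
  have "(\<Sum>A\<in>\<F>. emeasure M A) = (\<Sum>A\<in>\<F>. \<integral>\<^sup>+p. indicator A p \<partial>M)"
    using sets(1) by (intro sum.cong) auto
  also have "\<dots> = (\<integral>\<^sup>+p. (\<Sum>A\<in>\<F>. indicator A p) \<partial>M)"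
    using sets(1) by (intro nn_integral_sum[symmetric]) auto
  also have "\<dots> \<le> (\<integral>\<^sup>+p. ennreal c * indicator D p \<partial>M)"
  proof (rule nn_integral_mono)
    fix p
    have count: "(\<Sum>A\<in>\<F>. indicator A p) = ennreal (real (card {A \<in> \<F>. p \<in> A}))"
      using \<open>finite \<F>\<close>
      by (simp add: indicator_def sum.If_cases Int_def ennreal_of_nat_eq_real_of_nat)
    show "(\<Sum>A\<in>\<F>. indicator A p) \<le> ennreal c * indicator D p"
    proof (cases "p \<in> D")
      case True
      then show ?thesis
        using multiplicity unfolding count by (simp add: multiplicity_le_def ennreal_leI)
    next
      case False
      then have "{A \<in> \<F>. p \<in> A} = {}"
        using subset by blast
      then show ?thesis
        unfolding count by (simp only: card.empty) simp
    qed
  qed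
  also have "\<dots> = ennreal c * emeasure M D"
    using sets(2) by (simp add: nn_integral_cmult_indicator)
  finally show ?thesis .
qed

lemma d_inn_le:
  assumes "\<And>\<F>. \<lbrakk>finite \<F>; \<F> \<subseteq> {A \<in> \<A>. A \<subseteq> D}\<rbrakk> \<Longrightarrow> (\<Sum>A\<in>\<F>. emeasure \<mu> A) \<le> c * emeasure \<mu> D"
  shows "d_inn \<mu> \<A> D \<le> c"
proof -
  define S where "S = (SUP \<F> \<in> {\<F>. finite \<F> \<and> \<F> \<subseteq> {A \<in> \<A>. A \<subseteq> D}}. \<Sum>A\<in>\<F>. emeasure \<mu> A)"
  have "S \<le> c * emeasure \<mu> D"
    unfolding S_def using assms by (intro SUP_least) auto
  then have "S / emeasure \<mu> D \<le> c"
    by (cases "emeasure \<mu> D = 0")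
      (auto simp: zero_less_iff_neq_zero mult.commute intro!: divide_le_posI_ennreal)
  then show ?thesis
    by (simp add: d_inn_def S_def)
qed

lemma d_low_le_of_sequence:
  assumes "filterlim \<rho> at_top sequentially" "\<And>k::nat. d_inn \<mu> \<A> (ball 0 (\<rho> k)) \<le> c"
  shows "d_low \<mu> \<A> \<le> c"
proof (rule ccontr)
  assume "\<not> d_low \<mu> \<A> \<le> c"
  then have "\<forall>\<^sub>F t in at_top. c < d_inn \<mu> \<A> (ball 0 t)"
    unfolding d_low_def by (intro less_LiminfD) simp
  then have "\<forall>\<^sub>F k in sequentially. c < d_inn \<mu> \<A> (ball 0 (\<rho> k))"
    using assms(1) by (rule eventually_compose_filterlim)
  then show False
    using assms(2) by (auto simp: eventually_sequentially not_le[symmetric])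
qed

text \<open>\<open>E k\<close> collects the sets chosen for the shells up to radius \<open>\<rho> k\<close>.\<close>

locale shell_covering =
  fixes \<mu> :: "'a::euclidean_space measure" and c :: real
    and \<rho> :: "nat \<Rightarrow> real" and E :: "nat \<Rightarrow> 'a set set"
  assumes radius_step: "\<rho> k + 1 \<le> \<rho> (Suc k)"
    and stage_finite: "finite (E k)"
    and stage_sets: "E k \<subseteq> sets \<mu>"
    and stage_covers: "ball 0 (\<rho> k) \<subseteq> \<Union>(E k)"
    and stage_step: "E k \<subseteq> E (Suc k)"
    and new_escapes: "A \<in> E (Suc k) - E k \<Longrightarrow> \<not> A \<subseteq> ball 0 (\<rho> k)"
    and new_multiplicity: "multiplicity_le (E (Suc k) - E k) c"
    and old_negligible: "(\<Sum>A\<in>E k. emeasure \<mu> A) \<le> emeasure \<mu> (ball 0 (\<rho> (Suc k)))"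
    and ball_sets: "ball 0 r \<in> sets \<mu>"
begin

lemma radius_mono:
  assumes "i \<le> j"
  shows "\<rho> i \<le> \<rho> j"
proof -
  have "\<rho> k \<le> \<rho> (Suc k)" for k
    using radius_step[of k] by simp
  then show ?thesis
    using assms by (rule lift_Suc_mono_le)
qed

lemma stage_mono: "i \<le> j \<Longrightarrow> E i \<subseteq> E j"
  using stage_step by (rule lift_Suc_mono_le)

lemma radius_at_top: "filterlim \<rho> at_top sequentially"
proof -
  have linear: "\<rho> 0 + real k \<le> \<rho> k" for k
  proof (induction k)
    case (Suc k)
    then show ?case
      using radius_step[of k] by simp
  qed simp
  have "filterlim (\<lambda>k. \<rho> 0 + real k) at_top sequentially"
    by (rule filterlim_tendsto_add_at_top[OF tendsto_const filterlim_real_sequentially])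
  then show ?thesis
    by (rule filterlim_at_top_mono) (simp add: linear)
qed

lemma Union_stages: "\<Union>(\<Union>k. E k) = UNIV"
proof -
  have "p \<in> \<Union>(\<Union>k. E k)" for p
  proof -
    have "\<forall>\<^sub>F k in sequentially. norm p < \<rho> k"
      using radius_at_top unfolding filterlim_at_top_dense by blast
    then obtain k where "p \<in> ball 0 (\<rho> k)"
      by (auto simp: eventually_sequentially)
    then show ?thesis
      using stage_covers[of k] by blast
  qed
  then show ?thesis by blast
qed

lemma mem_stage_of_subset_ball:
  assumes "A \<in> E j" "A \<subseteq> ball 0 (\<rho> k)"
  shows "A \<in> E k"
proof (cases "j \<le> k")
  case True
  then show ?thesis
    using assms(1) stage_mono by blast
next
  case False
  then have "k \<le> j" by simp
  then show ?thesis
    using assms(1)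
  proof (induction rule: dec_induct)
    case (step i)
    have "ball 0 (\<rho> k) \<subseteq> ball (0::'a) (\<rho> i)"
      using step by (intro subset_ball radius_mono) auto
    then have "A \<subseteq> ball 0 (\<rho> i)"
      using assms(2) by blast
    then show ?case
      using step new_escapes by blast
  qed
qed

lemma d_inn_stages_le: "d_inn \<mu> (\<Union>k. E k) (ball 0 (\<rho> (Suc k))) \<le> ennreal c + 1"
proof (rule d_inn_le)
  define D where "D = ball (0::'a) (\<rho> (Suc k))"
  fix \<F> assume \<F>: "finite \<F>" "\<F> \<subseteq> {A \<in> (\<Union>k. E k). A \<subseteq> ball 0 (\<rho> (Suc k))}"
  then have stage: "\<F> \<subseteq> E (Suc k)"
    using mem_stage_of_subset_ball by blast
  have "(\<Sum>A\<in>\<F> \<inter> E k. emeasure \<mu> A) \<le> (\<Sum>A\<in>E k. emeasure \<mu> A)"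
    using stage_finite by (intro sum_mono2) auto
  also have "\<dots> \<le> emeasure \<mu> D"
    unfolding D_def by (rule old_negligible)
  finally have old: "(\<Sum>A\<in>\<F> \<inter> E k. emeasure \<mu> A) \<le> emeasure \<mu> D" .
  have "\<F> - E k \<subseteq> E (Suc k) - E k"
    using stage by blast
  then have new: "(\<Sum>A\<in>\<F> - E k. emeasure \<mu> A) \<le> ennreal c * emeasure \<mu> D"
    using \<F> stage stage_sets[of "Suc k"] multiplicity_le_subset[OF new_multiplicity]
    by (intro sum_emeasure_le_multiplicity) (auto simp: D_def ball_sets)
  have "(\<Sum>A\<in>\<F>. emeasure \<mu> A)
      = (\<Sum>A\<in>\<F> \<inter> E k. emeasure \<mu> A) + (\<Sum>A\<in>\<F> - E k. emeasure \<mu> A)"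
    using \<F>(1) by (rule sum.Int_Diff)
  also have "\<dots> \<le> emeasure \<mu> D + ennreal c * emeasure \<mu> D"
    using old new by (rule add_mono)
  also have "\<dots> = (ennreal c + 1) * emeasure \<mu> D"
    by (simp add: distrib_right add.commute)
  finally show "(\<Sum>A\<in>\<F>. emeasure \<mu> A) \<le> (ennreal c + 1) * emeasure \<mu> (ball 0 (\<rho> (Suc k)))"
    by (simp add: D_def)
qed

lemma d_low_stages_le: "d_low \<mu> (\<Union>k. E k) \<le> ennreal c + 1"
  using filterlim_compose[OF radius_at_top filterlim_Suc] d_inn_stages_le
  by (rule d_low_le_of_sequence)

end

lemma exists_shell_extension:
  fixes \<mu> :: "'a::euclidean_space measure"
  assumes lf: "locally_finite_borel \<mu>" and infinite: "emeasure \<mu> UNIV = \<infinity>"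
    and finite_measure: "\<And>A. A \<in> \<A> \<Longrightarrow> emeasure \<mu> A < \<infinity>" and cover: "covers_bounded_sets \<A> c"
    and \<E>: "finite \<E>" "\<E> \<subseteq> \<A>" "ball 0 r \<subseteq> \<Union>\<E>"
  obtains r' \<E>' where "r + 1 \<le> r'" "finite \<E>'" "\<E>' \<subseteq> \<A>" "ball 0 r' \<subseteq> \<Union>\<E>'" "\<E> \<subseteq> \<E>'"
    "\<And>A. A \<in> \<E>' - \<E> \<Longrightarrow> \<not> A \<subseteq> ball 0 r" "multiplicity_le (\<E>' - \<E>) c"
    "(\<Sum>A\<in>\<E>. emeasure \<mu> A) \<le> emeasure \<mu> (ball 0 r')"
proof -
  have "(\<Sum>A\<in>\<E>. emeasure \<mu> A) < \<infinity>"
    using \<E> finite_measure by auto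
  then obtain k where k: "(\<Sum>A\<in>\<E>. emeasure \<mu> A) < emeasure \<mu> (ball 0 k)"
    using exists_ball_emeasure_gt[OF lf infinite] by blast
  define r' where "r' = max (r + 1) k"
  define shell where "shell = ball 0 r' - ball (0::'a) r"
  have "bounded shell"
    unfolding shell_def by (rule bounded_diff) simp
  then obtain \<F> where \<F>: "\<F> \<subseteq> \<A>" "finite \<F>" "shell \<subseteq> \<Union>\<F>"
    "\<And>A. A \<in> \<F> \<Longrightarrow> A \<inter> shell \<noteq> {}" "multiplicity_le \<F> c"
    using cover unfolding covers_bounded_sets_def by metis
  show thesis
  proof
    show "finite (\<E> \<union> \<F>)" "\<E> \<union> \<F> \<subseteq> \<A>" "\<E> \<subseteq> \<E> \<union> \<F>" "r + 1 \<le> r'"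
      using \<E> \<F> by (auto simp: r'_def)
    show "ball 0 r' \<subseteq> \<Union>(\<E> \<union> \<F>)"
      using \<E>(3) \<F>(3) unfolding shell_def by blast
    show "\<not> A \<subseteq> ball 0 r" if "A \<in> \<E> \<union> \<F> - \<E>" for A
      using \<F>(4)[of A] that unfolding shell_def by blast
    show "multiplicity_le (\<E> \<union> \<F> - \<E>) c"
      using \<F>(5) by (rule multiplicity_le_subset) blast
    have "emeasure \<mu> (ball 0 k) \<le> emeasure \<mu> (ball 0 r')"
      by (rule emeasure_mono) (auto simp: r'_def sets_locally_finite_borel[OF lf])
    then show "(\<Sum>A\<in>\<E>. emeasure \<mu> A) \<le> emeasure \<mu> (ball 0 r')"
      using k by simp
  qed
qed

lemma exists_shell_covering:
  fixes \<mu> :: "'a::euclidean_space measure"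
  assumes lf: "locally_finite_borel \<mu>" and infinite: "emeasure \<mu> UNIV = \<infinity>"
    and sets: "\<A> \<subseteq> sets \<mu>" and finite_measure: "\<And>A. A \<in> \<A> \<Longrightarrow> emeasure \<mu> A < \<infinity>"
    and cover: "covers_bounded_sets \<A> c"
  obtains \<rho> E where "shell_covering \<mu> c \<rho> E" "\<And>k. E k \<subseteq> \<A>"
proof -
  define stage where "stage s \<longleftrightarrow> finite (snd s) \<and> snd s \<subseteq> \<A> \<and> ball 0 (fst s) \<subseteq> \<Union>(snd s)"
    for s :: "real \<times> 'a set set"
  define extends where "extends s s' \<longleftrightarrow> fst s + 1 \<le> fst s' \<and> snd s \<subseteq> snd s'
      \<and> (\<forall>A\<in>snd s' - snd s. \<not> A \<subseteq> ball 0 (fst s)) \<and> multiplicity_le (snd s' - snd s) c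
      \<and> (\<Sum>A\<in>snd s. emeasure \<mu> A) \<le> emeasure \<mu> (ball 0 (fst s'))"
    for s s' :: "real \<times> 'a set set"
  have "\<exists>s'. stage s' \<and> extends s s'" if "stage s" for s
  proof -
    obtain r' \<E>' where "r' \<ge> fst s + 1" "finite \<E>'" "\<E>' \<subseteq> \<A>" "ball 0 r' \<subseteq> \<Union>\<E>'" "snd s \<subseteq> \<E>'"
      "\<And>A. A \<in> \<E>' - snd s \<Longrightarrow> \<not> A \<subseteq> ball 0 (fst s)" "multiplicity_le (\<E>' - snd s) c"
      "(\<Sum>A\<in>snd s. emeasure \<mu> A) \<le> emeasure \<mu> (ball 0 r')"
      using exists_shell_extension[OF lf infinite finite_measure cover] \<open>stage s\<close>
      unfolding stage_def by metis
    then show ?thesis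
      unfolding stage_def extends_def by (intro exI[of _ "(r', \<E>')"]) simp
  qed
  moreover have "stage (0, {})"
    by (simp add: stage_def)
  ultimately obtain s where s: "\<And>k. stage (s k)" "\<And>k. extends (s k) (s (Suc k))"
    using dependent_nat_choice[of "\<lambda>_. stage" "\<lambda>_. extends"] by metis
  show thesis
  proof
    have "snd (s k) \<subseteq> sets \<mu>" for k
      using s(1)[of k] sets by (auto simp: stage_def)
    then show "shell_covering \<mu> c (\<lambda>k. fst (s k)) (\<lambda>k. snd (s k))"
      using s sets_locally_finite_borel[OF lf]
      by unfold_locales (auto simp: stage_def extends_def)
    show "snd (s k) \<subseteq> \<A>" for k
      using s(1) by (simp add: stage_def)
  qed
qed

lemma (in asymmetric_body) exists_cover_d_low_le:
  assumes lf: "locally_finite_borel \<mu>" and "non_degenerate \<mu> C" "emeasure \<mu> UNIV = \<infinity>"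
    and "0 < m" "m < \<infinity>"
  obtains \<C> where "\<Union>\<C> = UNIV" "\<C> \<subseteq> homothets_of_measure \<mu> C m"
    "d_low \<mu> \<C> \<le> ennreal ((4 * n + 5) ^ DIM('a)) + 1"
proof -
  define c where "c = (4 * n + 5) ^ DIM('a)"
  have "covers_bounded_sets (homothets_of_measure \<mu> C m) c"
    unfolding c_def using assms by (rule covers_bounded_sets_homothets_of_measure)
  moreover have "homothets_of_measure \<mu> C m \<subseteq> sets \<mu>"
    using homothet_in_sets[OF lf compact]
    by (auto simp: homothets_of_measure_def is_homothet_of_def)
  moreover have "emeasure \<mu> A < \<infinity>" if "A \<in> homothets_of_measure \<mu> C m" for A
    using that assms(5) by (simp add: homothets_of_measure_def)
  ultimately obtain \<rho> E where E: "shell_covering \<mu> c \<rho> E" "\<And>k. E k \<subseteq> homothets_of_measure \<mu> C m"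
    using exists_shell_covering[OF lf assms(3)] by metis
  interpret shell_covering \<mu> c \<rho> E by fact
  show thesis
  proof
    show "\<Union>(\<Union>k. E k) = UNIV" "(\<Union>k. E k) \<subseteq> homothets_of_measure \<mu> C m"
      using Union_stages E(2) by blast+
    show "d_low \<mu> (\<Union>k. E k) \<le> ennreal ((4 * n + 5) ^ DIM('a)) + 1"
      using d_low_stages_le by (simp only: c_def)
  qed
qed

lemma homothety_covering_density_le_d_low:
  assumes "\<Union>\<C> = UNIV" "\<C> \<subseteq> homothets_of_measure \<mu> C (emeasure \<mu> C)"
  shows "homothety_covering_density \<mu> C \<le> d_low \<mu> \<C>"
  unfolding homothety_covering_density_def
  using assms by (intro INF_lower) (auto simp: homothets_of_measure_def)

theorem mainTheorem4:
  "\<exists>F :: nat \<Rightarrow> real. \<forall>(C :: 'a::euclidean_space set) (\<mu> :: 'a measure).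
     convex_body C \<and> locally_finite_borel \<mu> \<and> non_degenerate \<mu> C \<and>
     emeasure \<mu> C > 0 \<and> emeasure \<mu> UNIV = \<infinity> \<longrightarrow>
     homothety_covering_density \<mu> C \<le> ennreal (F DIM('a))"
proof (intro exI[of _ "\<lambda>d. (4 * real d + 5) ^ d + 1"] allI impI, elim conjE)
  fix C :: "'a set" and \<mu> :: "'a measure"
  assume C: "convex_body C" and lf: "locally_finite_borel \<mu>" and nd: "non_degenerate \<mu> C"
    and pos: "emeasure \<mu> C > 0" and infinite: "emeasure \<mu> UNIV = \<infinity>"
  obtain c where c: "asymmetric_body (homothet 1 (- c) C) (real DIM('a))"
    using convex_body_translate_asymmetric[OF C] by blast
  have finite: "emeasure \<mu> C < \<infinity>"
    using C lf by (auto simp: convex_body_def locally_finite_borel_def)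
  have "non_degenerate \<mu> (homothet 1 (- c) C)"
    using nd by (rule non_degenerate_homothet) simp
  then obtain \<C> where \<C>: "\<Union>\<C> = UNIV"
    "\<C> \<subseteq> homothets_of_measure \<mu> (homothet 1 (- c) C) (emeasure \<mu> C)"
    "d_low \<mu> \<C> \<le> ennreal ((4 * real DIM('a) + 5) ^ DIM('a)) + 1"
    using asymmetric_body.exists_cover_d_low_le[OF c lf _ infinite pos finite] by metis
  then have "homothety_covering_density \<mu> C \<le> d_low \<mu> \<C>"
    by (intro homothety_covering_density_le_d_low)
      (auto simp: homothets_of_measure_def is_homothet_of_homothet)
  also have "\<dots> \<le> ennreal ((4 * real DIM('a) + 5) ^ DIM('a) + 1)"
    using \<C>(3) by (simp add: ennreal_plus)
  finally show "homothety_covering_density \<mu> C \<le> ennreal ((4 * real DIM('a) + 5) ^ DIM('a) + 1)" .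
qed

end
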